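(* Let $\mathbb{F}_q$ be a finite field with $q=p^k$ elements, where $p\equiv 1\pmod 3$ is prime, and let $a_1,a_2,a_3\in\mathbb{F}_q^{\ast}$. Let $M_k(a_1,a_2,a_3)$ denote the number of $(x_1,x_2,x_3)\in\mathbb{F}_q^3$ with $a_1x_1^3+a_2x_2^3+a_3x_3^3=0$. Then $$M_k(a_1,a_2,a_3)=\begin{cases} q^2+c(q-1), & \text{if } a_1a_2a_3 \text{ is cubic},\\ q^2+\frac{1}{2}(q-1)(9d-c), & \text{if } a_1a_2a_3 \text{ is non-cubic},\end{cases}$$ where $c,d$ are the integers uniquely determined by $$4q=c^2+27d^2,\quad c\equiv 1\pmod 3,\quad (c,p)=1,\quad 9d\equiv c\left(2(a_1a_2a_3)^{\frac{q-1}{3}}+1\right)\pmod p,$$ with $(a_1a_2a_3)^{(q-1)/3}\in\mathbb{F}_p$ identified with an integer residue mod $p$.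
   Context: An element $z\in\mathbb{F}_q^{\ast}$ is called cubic if $z=y^3$ for some $y\in\mathbb{F}_q^{\ast}$, and non-cubic otherwise.
   Formalization: When a1a2a3 is cubic, the congruence 9d ≡ c(2(a1a2a3)^((q-1)/3)+1) (mod p) contradicts the other three conditions (it forces p | c), so it is imposed only in the non-cubic case; in the cubic case c is unique and d is determined only up to sign. *)

theory Defs
  imports Complex_Main "HOL-Library.Cardinality" "HOL-Number_Theory.Cong" "HOL-Computational_Algebra.Primes"
begin

definition is_cubic :: "'a::field \<Rightarrow> bool" where
  "is_cubic z \<longleftrightarrow> (\<exists>y. y \<noteq> 0 \<and> z = y ^ 3)"

definition cubic_zeros :: "'a::field \<Rightarrow> 'a \<Rightarrow> 'a \<Rightarrow> ('a \<times> 'a \<times> 'a) set" where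
  "cubic_zeros a1 a2 a3 = {(x1, x2, x3). a1 * x1 ^ 3 + a2 * x2 ^ 3 + a3 * x3 ^ 3 = 0}"

definition norm_rep :: "nat \<Rightarrow> nat \<Rightarrow> int \<Rightarrow> int \<Rightarrow> bool" where
  "norm_rep p q c d \<longleftrightarrow>
     4 * int q = c\<^sup>2 + 27 * d\<^sup>2 \<and> [c = 1] (mod 3) \<and> coprime c (int p)"

text \<open>The congruence \<open>9 d \<equiv> c (2 A\<^bsup>(q-1)/3\<^esup> + 1) (mod p)\<close>: the power of \<open>A\<close> lies in the
  prime field, and \<open>t\<close> is an integer representing it (unique modulo \<open>p\<close> when the field
  has characteristic \<open>p\<close>). Such \<open>d\<close> exist alongside \<^const>\<open>norm_rep\<close> only for non-cubic \<open>A\<close>: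
  if the power is 1, the congruence reads \<open>9 d \<equiv> 3 c\<close>, whence \<open>4 q = c\<^sup>2 + 27 d\<^sup>2 \<equiv> 4 c\<^sup>2\<close>
  and \<open>p\<close> divides \<open>c\<close>.\<close>

definition sign_cong :: "nat \<Rightarrow> nat \<Rightarrow> 'a::field \<Rightarrow> int \<Rightarrow> int \<Rightarrow> bool" where
  "sign_cong p q A c d \<longleftrightarrow>
     (\<exists>t::int. of_int t = A ^ ((q - 1) div 3) \<and> [9 * d = c * (2 * t + 1)] (mod int p))"

end

theory Submission
  imports Defs "HOL-Computational_Algebra.Polynomial"
begin

text \<open>
  Put \<open>m = (q - 1) / 3\<close> and let \<open>w\<close> be a primitive cube root of unity of the field. The cubic character
  \<open>\<chi>\<close> sends \<open>x \<noteq> 0\<close> to the complex cube root of unity corresponding to \<open>x\<^bsup>m\<^esup> \<in> {1, w, w\<^sup>2}\<close>. Expanding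
  the number of cube roots as \<open>1 + \<chi> + \<chi>\<^bsup>-1\<^esup>\<close> gives \<open>M = q\<^sup>2 + (q - 1) 2 Re (\<chi>\<^bsup>-1\<^esup>(a\<^sub>1 a\<^sub>2 a\<^sub>3) J)\<close> with the Jacobi
  sum \<open>J = \<Sum>\<^sub>x \<chi>(x) \<chi>(1 - x) = n\<^sub>0 + n\<^sub>1 \<omega> + n\<^sub>2 \<omega>\<^sup>2\<close>, where \<open>n\<^sub>i\<close> counts the \<open>x\<close> with \<open>(x (1 - x))\<^bsup>m\<^esup> = w\<^bsup>i\<^esup>\<close>.
  Set \<open>c = 2 n\<^sub>0 - n\<^sub>1 - n\<^sub>2\<close> and \<open>3 d = n\<^sub>1 - n\<^sub>2\<close>. Then \<open>|J|\<^sup>2 = q\<close> is the norm equation; an order 3 symmetry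
  of \<open>x (1 - x)\<close> gives the congruences modulo 3; and power sums in the field show that \<open>J\<close> reduces
  to 0 under \<open>\<omega> \<mapsto> w\<close>, which is the congruence between \<open>c\<close> and \<open>d\<close>, while its conjugate reduces to
  \<open>\<plusminus> binomial (2 m, m) \<noteq> 0\<close>, so \<open>p\<close> does not divide \<open>c\<close>. In the non-cubic case one takes
  \<open>w = (a\<^sub>1 a\<^sub>2 a\<^sub>3)\<^bsup>m\<^esup>\<close>.
\<close>

section \<open>Integers\<close>

text \<open>The \<open>n\<close> multiples of \<open>p\<close> among the factors contribute
  \<open>p ^ n * fact n\<close>; all other factors are prime to \<open>p\<close>. Keeping
  \<open>fact n\<close> explicit allows base \<open>p\<close> digits to be stripped one at a
  time.\<close>

lemma fact_mult_prime_add: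
  fixes p :: nat
  assumes p: "prime p" and "r < p"
  shows "\<exists>u. fact (p * n + r) = p ^ n * fact n * u \<and> \<not> p dvd u"
  using \<open>r < p\<close>
proof (induction n arbitrary: r)
  case 0
  then show ?case using prime_dvd_fact_iff[OF p] by auto
next
  case (Suc n)
  from \<open>r < p\<close> show ?case
  proof (induction r)
    case 0
    obtain u where u: "fact (p * n + (p - 1)) = p ^ n * fact n * u" "\<not> p dvd u"
      using Suc.IH[of "p - 1"] prime_gt_0_nat[OF p] by auto
    \<comment> \<open>The number after the largest remainder \<open>p - 1\<close> is the next
      multiple of \<open>p\<close>; it supplies the new factors \<open>p\<close> and
      \<open>Suc n\<close>.\<close>
    have eq: "p * Suc n + 0 = Suc (p * n + (p - 1))"
      using prime_gt_0_nat[OF p] by simp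
    have "fact (p * Suc n + 0) = (p * Suc n) * (fact (p * n + (p - 1)) :: nat)"
      unfolding eq fact_Suc using eq by simp
    also have "\<dots> = p ^ Suc n * fact (Suc n) * u"
      unfolding u(1) fact_Suc power_Suc by (simp only: of_nat_id mult_ac)
    finally show ?case using u(2) by blast
  next
    case (Suc r)
    then obtain u where u: "fact (p * Suc n + r) = p ^ Suc n * fact (Suc n) * u" "\<not> p dvd u"
      by auto
    have "\<not> p dvd p * Suc n + Suc r"
      using Suc.prems by (metis dvd_add_right_iff dvd_triv_left nat_dvd_not_less zero_less_Suc)
    moreover have "fact (p * Suc n + Suc r)
        = p ^ Suc n * fact (Suc n) * (u * (p * Suc n + Suc r))"
      using u(1) by (simp only: add_Suc_right fact_Suc of_nat_id mult_ac)
    ultimately show ?case using u(2) p by (metis prime_dvd_mult_iff)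
  qed
qed

text \<open>The base \<open>p\<close> digits of \<open>m\<close> all equal \<open>(p - 1) / 3\<close>, so adding \<open>m + m\<close> causes no carries.\<close>
lemma prime_not_dvd_central_binomial:
  fixes p m k :: nat
  assumes p: "prime p" and p3: "[p = 1] (mod 3)" and "p ^ k = 3 * m + 1"
  shows "\<not> p dvd (2 * m choose m)"
  using \<open>p ^ k = 3 * m + 1\<close>
proof (induction k arbitrary: m)
  case 0
  then show ?case using prime_gt_1_nat[OF p] by auto
next
  case (Suc k)
  obtain r where r: "p = 3 * r + 1"
    using p3 prime_gt_0_nat[OF p] by (metis add.commute cong_to_1_nat dvdE le_add_diff_inverse Suc_leI One_nat_def)
  obtain n where n: "p ^ k = 3 * n + 1"
  proof -
    have "[p ^ k = 1 ^ k] (mod 3)" by (rule cong_pow[OF p3])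
    then have "3 dvd p ^ k - 1" using cong_to_1_nat by (metis power_one)
    moreover have "p ^ k \<ge> 1" using prime_gt_0_nat[OF p] by simp
    ultimately show ?thesis using that by (metis add.commute dvdE le_add_diff_inverse)
  qed
  have "3 * m + 1 = p * (3 * n + 1)" using Suc.prems n by simp
  also have "\<dots> = 3 * (p * n + r) + 1" using r by (simp add: algebra_simps)
  \<comment> \<open>So \<open>r\<close> is the last base \<open>p\<close> digit of \<open>m\<close>,
    and \<open>2 * r < p\<close> means that doubling carries nothing into \<open>n\<close>.\<close>
  finally have m: "m = p * n + r" by simp
  have rp: "r < p" "2 * r < p" using r by auto
  obtain u where u: "fact (p * n + r) = p ^ n * fact n * u" "\<not> p dvd u"
    using fact_mult_prime_add[OF p rp(1)] by blast
  obtain v where v: "fact (p * (2 * n) + 2 * r) = p ^ (2 * n) * fact (2 * n) * v" "\<not> p dvd v"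
    using fact_mult_prime_add[OF p rp(2)] by blast
  have C1: "fact m * fact m * (2 * m choose m) = (fact (2 * m) :: nat)"
    using binomial_fact_lemma[of m "2 * m"] by simp
  have C2: "fact n * fact n * (2 * n choose n) = (fact (2 * n) :: nat)"
    using binomial_fact_lemma[of n "2 * n"] by simp
  have "2 * m = p * (2 * n) + 2 * r" using m by simp
  then have "(p ^ n * fact n * u) * (p ^ n * fact n * u) * (2 * m choose m)
      = p ^ (2 * n) * (fact n * fact n * (2 * n choose n)) * v"
    using C1 C2 u(1) v(1) m by metis
  then have "(p ^ n * p ^ n * fact n * fact n) * (u * u * (2 * m choose m))
      = (p ^ n * p ^ n * fact n * fact n) * ((2 * n choose n) * v)"
    unfolding mult_2 power_add by (simp only: mult_ac)
  \<comment> \<open>Stripping a digit leaves the central binomial for \<open>n\<close>, up to the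
    factors \<open>u\<close> and \<open>v\<close> prime to \<open>p\<close>.\<close>
  then have "u * u * (2 * m choose m) = (2 * n choose n) * v"
    using prime_gt_0_nat[OF p] by (subst (asm) mult_cancel1) auto
  then show ?case
    using Suc.IH[OF n] v(2) p by (metis dvd_triv_right prime_dvd_mult_iff dvd_mult)
qed

text \<open>In terms of the elements (c + 3 d sqrt(-3)) / 2 of norm \<open>p ^ k\<close> this is
  uniqueness up to conjugation. \<open>Q\<close> divides c d' - c' d or c d' + c' d, and a size
  bound makes that factor vanish. The residue modulo 3 fixes the sign of \<open>c\<close>; the sign
  of \<open>d\<close> stays open.\<close>

lemma norm_rep_unique:
  fixes p k :: nat
  assumes p: "prime p" "p > 3"
    and r: "norm_rep p (p ^ k) c d" and r': "norm_rep p (p ^ k) c' d'" and k: "k > 0"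
  shows "c' = c \<and> (d' = d \<or> d' = - d)"
proof -
  define Q where "Q = int p ^ k"
  have P: "prime (int p)" using p by simp
  have Q0: "Q > 0" using p by (auto simp: Q_def)
  have pQ: "int p dvd Q" using k by (auto simp: Q_def)
  have e: "4 * Q = c\<^sup>2 + 27 * d\<^sup>2" "4 * Q = c'\<^sup>2 + 27 * d'\<^sup>2"
    and c3: "[c = 1] (mod 3)" "[c' = 1] (mod 3)"
    and cp: "\<not> int p dvd c" "\<not> int p dvd c'"
    using r r' P by (auto simp: norm_rep_def Q_def coprime_commute
        dest: prime_imp_coprime coprime_absorb_left)
  \<comment> \<open>The two factors add up to this number, so \<open>p\<close> cannot divide both,
    and all of \<open>Q\<close> goes into one of them.\<close>
  have ndvd: "\<not> int p dvd 2 * c * d'"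
  proof
    assume "int p dvd 2 * c * d'"
    moreover have "\<not> int p dvd 2" using p by (auto dest: zdvd_imp_le)
    ultimately have "int p dvd d'" using cp P by (metis prime_dvd_mult_iff)
    then have "int p dvd 4 * Q - 27 * d'\<^sup>2" using pQ by (simp add: power2_eq_square)
    then have "int p dvd c'\<^sup>2" using e(2) by (metis add_diff_cancel_right')
    then show False using cp P prime_dvd_power by blast
  qed
  have prod: "(c * d' - c' * d) * (c * d' + c' * d) = 4 * Q * (d'\<^sup>2 - d\<^sup>2)"
    using e by algebra
  have dv: "Q dvd (c * d' - c' * d) * (c * d' + c' * d)" unfolding prod by simp
  have "Q dvd c * d' - c' * d \<or> Q dvd c * d' + c' * d"
  proof (cases "int p dvd c * d' - c' * d")
    case False
    then have "coprime Q (c * d' - c' * d)"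
      unfolding Q_def using P by (simp add: prime_imp_coprime)
    then show ?thesis using dv by (simp add: coprime_dvd_mult_right_iff)
  next
    case True
    then have "\<not> int p dvd c * d' + c' * d"
      using ndvd dvd_add[of "int p" "c * d' - c' * d" "c * d' + c' * d"] by (auto simp: mult.assoc)
    then have "coprime Q (c * d' + c' * d)"
      unfolding Q_def using P by (simp add: prime_imp_coprime)
    then show ?thesis using dv by (simp add: coprime_dvd_mult_left_iff)
  qed
  then obtain s where s: "Q dvd c * d' - s * c' * d" and ss: "s = 1 \<or> s = -1"
    by (metis diff_minus_eq_add mult_minus1 mult_1 mult_minus_left)
  have "(c * d' - s * c' * d) = 0"
  proof (rule ccontr)
    assume nz: "c * d' - s * c' * d \<noteq> 0"
    \<comment> \<open>Brahmagupta's identity for the norm form. A nonzero multiple of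
      \<open>Q\<close> in the second square would give 27 Q^2 \<le> 16 Q^2.\<close>
    have "(s * (c * c') + 27 * d * d')\<^sup>2 + 27 * (c * d' - s * c' * d)\<^sup>2 = 16 * Q\<^sup>2"
      using e ss by algebra
    then have "27 * (c * d' - s * c' * d)\<^sup>2 \<le> 16 * Q\<^sup>2"
      by (smt (verit) zero_le_power2)
    moreover have "\<bar>Q\<bar> \<le> \<bar>c * d' - s * c' * d\<bar>"
      using s nz by (simp add: dvd_imp_le_int)
    then have "Q\<^sup>2 \<le> (c * d' - s * c' * d)\<^sup>2" by (simp add: abs_le_square_iff)
    moreover have "Q\<^sup>2 > 0" using Q0 by simp
    ultimately show False by linarith
  qed
  then have "(c * d' - c' * d) * (c * d' + c' * d) = 0" using ss by auto
  then have "d'\<^sup>2 = d\<^sup>2" using prod Q0 by simp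
  then have D: "d' = d \<or> d' = - d" and "c'\<^sup>2 = c\<^sup>2" using e by (auto simp: power2_eq_iff)
  then have "c' = c \<or> c' = - c" by (simp add: power2_eq_iff)
  moreover have "c' = c" if "c' = - c"
  proof -
    have "[c + c' = 1 + 1] (mod 3)" using c3 by (rule cong_add)
    then show ?thesis using that by (simp add: cong_def)
  qed
  ultimately show ?thesis using D by auto
qed

section \<open>Power sums in finite fields\<close>

text \<open>Translation by 1 permutes the field, so adding 1 to every element leaves the total
  unchanged.\<close>

lemma of_nat_card_eq_0: "of_nat CARD('a::{field,finite}) = (0::'a)"
proof -
  have "(\<Sum>x\<in>UNIV. x + 1) = (\<Sum>x\<in>UNIV. x :: 'a)"
    by (rule sum.reindex_bij_witness[of _ "\<lambda>x. x - 1" "\<lambda>x. x + 1"]) auto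
  then show ?thesis by (simp add: sum.distrib)
qed

text \<open>This carries congruences modulo \<open>p\<close> to equations in the field and back;
  Bezout's identity excludes further zeros.\<close>

lemma of_int_eq_0_iff_dvd:
  fixes p :: nat
  assumes "prime p" and "CARD('a::{field,finite}) = p ^ k"
  shows "(of_int n :: 'a) = 0 \<longleftrightarrow> int p dvd n"
proof -
  have p0: "(of_nat p :: 'a) = 0"
    using of_nat_card_eq_0[where 'a = 'a] assms(2) by simp
  show ?thesis
  proof
    assume n: "(of_int n :: 'a) = 0"
    show "int p dvd n"
    proof (rule ccontr)
      assume "\<not> int p dvd n"
      then have "coprime (int p) n" using assms(1) by (simp add: prime_imp_coprime)
      then obtain a b where "a * int p + b * n = 1"
        using bezout_int[of "int p" n] by (auto simp: coprime_iff_gcd_eq_1)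
      then have "(of_int (a * int p + b * n) :: 'a) = of_int 1" by simp
      then show False using n p0 by simp
    qed
  next
    assume "int p dvd n"
    then show "(of_int n :: 'a) = 0" using p0 by (auto simp: dvd_def)
  qed
qed

text \<open>Multiplication by \<open>x\<close> permutes the nonzero elements; compare their
  products.\<close>

lemma power_card_minus_1:
  fixes x :: "'a::{field,finite}"
  assumes "x \<noteq> 0"
  shows "x ^ (CARD('a) - 1) = 1"
proof -
  have "(\<Prod>y\<in>UNIV - {0}. x * y) = (\<Prod>y\<in>UNIV - {0}. y)"
    by (rule prod.reindex_bij_witness[of _ "\<lambda>y. y / x" "\<lambda>y. x * y"]) (use assms in auto)
  then show ?thesis by (simp add: prod.distrib card_Diff_singleton)
qed

lemma card_power_eq_1_le:
  fixes n :: nat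
  assumes "n > 0"
  shows "card {x :: 'a::{field,finite}. x ^ n = 1} \<le> n"
proof -
  define P where "P = monom (1 :: 'a) n - 1"
  have "coeff P n = 1" using assms by (simp add: P_def coeff_1)
  then have nz: "P \<noteq> 0" by auto
  have "{x :: 'a. x ^ n = 1} = {x. poly P x = 0}" by (simp add: P_def poly_monom)
  then have "card {x :: 'a. x ^ n = 1} \<le> degree P" using card_poly_roots_bound[OF nz] by simp
  also have "\<dots> \<le> n" unfolding P_def by (intro degree_diff_le) (auto simp: degree_monom_le)
  finally show ?thesis .
qed

text \<open>Otherwise X^n - 1 would have too many roots. This replaces a generator of the
  multiplicative group wherever a nontrivial character value is wanted.\<close>

lemma ex_power_neq_1:
  fixes n :: nat
  assumes "n > 0" "n < CARD('a::{field,finite}) - 1"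
  shows "\<exists>z::'a. z \<noteq> 0 \<and> z ^ n \<noteq> 1"
proof (rule ccontr)
  assume "\<not> ?thesis"
  then have "UNIV - {0 :: 'a} \<subseteq> {x. x ^ n = 1}" by auto
  then have "CARD('a) - 1 \<le> card {x :: 'a. x ^ n = 1}"
    using card_mono[of "{x :: 'a. x ^ n = 1}" "UNIV - {0}"] by (auto simp: card_Diff_singleton)
  then show False using card_power_eq_1_le[OF assms(1), where 'a = 'a] assms(2) by simp
qed

text \<open>If \<open>n\<close> is not a multiple of q - 1, scaling by a suitable \<open>z\<close>
  multiplies the sum by a factor other than 1. For \<open>n = 0\<close> every term is 1, including
  0^0, and the sum is q = 0.\<close>

lemma sum_power_field:
  "(\<Sum>x::'a::{field,finite}\<in>UNIV. x ^ n) = (if n > 0 \<and> CARD('a) - 1 dvd n then -1 else 0)"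
proof (cases "n = 0")
  case True
  then show ?thesis using of_nat_card_eq_0[where 'a = 'a] by simp
next
  case False
  define M where "M = CARD('a) - 1"
  have M: "x ^ M = 1" if "x \<noteq> 0" for x :: 'a using power_card_minus_1[OF that] by (simp add: M_def)
  have "x ^ n = x ^ (n mod M)" if "x \<noteq> 0" for x :: 'a
  proof -
    have "x ^ n = x ^ (M * (n div M) + n mod M)" by simp
    also have "\<dots> = x ^ (n mod M)" unfolding power_add power_mult M[OF that] by simp
    finally show ?thesis .
  qed
  \<comment> \<open>The zero element is dropped from the index set because its term, 0 on the left,
    would become 0^0 = 1 when \<open>M\<close> divides \<open>n\<close>.\<close>
  then have nz: "(\<Sum>x::'a\<in>UNIV. x ^ n) = (\<Sum>x::'a\<in>UNIV - {0}. x ^ (n mod M))"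
    using False by (intro sum.mono_neutral_cong_right) auto
  show ?thesis
  proof (cases "M dvd n")
    case True
    have "(\<Sum>x::'a\<in>UNIV. x ^ n) = of_nat M" unfolding nz using True by (simp add: M_def card_Diff_singleton)
    also have "\<dots> = of_nat CARD('a) - 1" unfolding M_def by (simp add: of_nat_diff Suc_leI)
    finally show ?thesis using True False of_nat_card_eq_0[where 'a = 'a] by (simp add: M_def)
  next
    case ndvd: False
    have "card {0 :: 'a, 1} \<le> CARD('a)" by (intro card_mono) auto
    then have Mpos: "M > 0" by (simp add: M_def)
    then have "n mod M > 0" "n mod M < M" using ndvd by (auto simp: dvd_eq_mod_eq_0)
    then obtain z :: 'a where z: "z \<noteq> 0" "z ^ (n mod M) \<noteq> 1"
      using ex_power_neq_1[of "n mod M", where 'a = 'a] by (auto simp: M_def)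
    define S where "S = (\<Sum>x::'a\<in>UNIV - {0}. x ^ (n mod M))"
    have "S = (\<Sum>x::'a\<in>UNIV - {0}. (z * x) ^ (n mod M))" unfolding S_def
      by (rule sum.reindex_bij_witness[of _ "\<lambda>x. z * x" "\<lambda>x. x / z"]) (use z in auto)
    also have "\<dots> = z ^ (n mod M) * S" by (simp add: S_def power_mult_distrib sum_distrib_left)
    finally have "S = z ^ (n mod M) * S" .
    then have "S = 0" using z by auto
    then show ?thesis using nz ndvd by (simp add: S_def M_def)
  qed
qed

text \<open>Nonfixed points fall into orbits of exactly three elements; the induction removes one
  orbit at a time.\<close>

lemma three_dvd_card_nonfixed_points:
  assumes "finite A" and "\<And>x. x \<in> A \<Longrightarrow> f x \<in> A \<and> f (f (f x)) = x"
  shows "3 dvd card {x \<in> A. f x \<noteq> x}"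
  using assms
proof (induction "card A" arbitrary: A rule: less_induct)
  case less
  show ?case
  proof (cases "\<exists>x\<in>A. f x \<noteq> x")
    case False
    then have "{x \<in> A. f x \<noteq> x} = {}" by auto
    then show ?thesis by (simp only: card.empty dvd_0_right)
  next
    case True
    then obtain x where x: "x \<in> A" "f x \<noteq> x" by auto
    let ?O = "{x, f x, f (f x)}"
    have O: "?O \<subseteq> A" and f3: "f (f (f x)) = x" using less.prems(2) x by auto
    have d: "f (f x) \<noteq> x" "f (f x) \<noteq> f x" using f3 x by metis+
    have cl: "f y \<in> A - ?O \<and> f (f (f y)) = y" if "y \<in> A - ?O" for y
      using less.prems(2)[of y] that f3 by (smt (verit) Diff_iff insert_iff empty_iff)
    have lt: "card (A - ?O) < card A"
      using less.prems(1) x by (intro psubset_card_mono) auto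
    have IH: "3 dvd card {y \<in> A - ?O. f y \<noteq> y}"
      using less.hyps[OF lt] less.prems(1) cl by auto
    have "{y \<in> A. f y \<noteq> y} = {y \<in> A - ?O. f y \<noteq> y} \<union> ?O"
      using O d x f3 by auto
    moreover have "card ({y \<in> A - ?O. f y \<noteq> y} \<union> ?O) = card {y \<in> A - ?O. f y \<noteq> y} + 3"
      using less.prems(1) d x by (subst card_Un_disjoint) auto
    ultimately show ?thesis using IH by simp
  qed
qed

section \<open>The cubic character\<close>

definition omega :: complex where
  "omega = Complex (- 1 / 2) (sqrt 3 / 2)"

lemma cnj_omega: "cnj omega = omega\<^sup>2"
  by (simp add: omega_def complex_eq_iff power2_eq_square field_simps)

lemma omega_sum: "1 + omega + omega\<^sup>2 = 0"
  by (simp add: omega_def complex_eq_iff power2_eq_square field_simps)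

lemma omega_cubed: "omega ^ 3 = 1"
  using omega_sum by algebra

lemma omega_neq_1: "omega \<noteq> 1"
  by (simp add: omega_def complex_eq_iff)

lemma sum_shift_field:
  fixes f :: "'a::{field,finite} \<Rightarrow> 'b::comm_monoid_add"
  shows "(\<Sum>x\<in>UNIV. f (x + a)) = (\<Sum>x\<in>UNIV. f x)"
  by (rule sum.reindex_bij_witness[of _ "\<lambda>x. x - a" "\<lambda>x. x + a"]) auto

lemma sum_scale_field:
  fixes f :: "'a::{field,finite} \<Rightarrow> 'b::comm_monoid_add"
  assumes "a \<noteq> 0"
  shows "(\<Sum>x\<in>UNIV. f (a * x)) = (\<Sum>x\<in>UNIV. f x)"
  by (rule sum.reindex_bij_witness[of _ "\<lambda>x. x / a" "\<lambda>x. a * x"]) (use assms in auto)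

lemma sum_reflect_field:
  fixes f :: "'a::{field,finite} \<Rightarrow> 'b::comm_monoid_add"
  shows "(\<Sum>x\<in>UNIV. f (a - x)) = (\<Sum>x\<in>UNIV. f x)"
  by (rule sum.reindex_bij_witness[of _ "\<lambda>x. a - x" "\<lambda>x. a - x"]) auto

lemma card_sum_eq_convolution:
  fixes g h :: "'a::{field,finite} \<Rightarrow> 'a"
  shows "card {(x, y). g x + h y = t} = (\<Sum>s\<in>UNIV. card {x. g x = s} * card {y. h y = t - s})"
proof -
  have "{(x, y). g x + h y = t} = (\<Union>s. {x. g x = s} \<times> {y. h y = t - s})"
    by (auto simp: algebra_simps)
  also have "card \<dots> = (\<Sum>s\<in>UNIV. card ({x. g x = s} \<times> {y. h y = t - s}))"
    by (rule card_UN_disjoint) auto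
  finally show ?thesis by (simp add: card_cartesian_product)
qed

text \<open>The root \<open>w\<close> is a parameter so that it can be taken to be
  \<open>(a1 * a2 * a3) ^ m\<close> later. Replacing \<open>w\<close> by its square conjugates the
  character and flips the sign of \<open>d\<close>.\<close>

locale cubic_field =
  fixes w :: "'a::{field,finite}" and m :: nat
  assumes card_field: "CARD('a) = 3 * m + 1"
    and w: "w\<^sup>2 + w + 1 = 0"
    and three: "(3 :: 'a) \<noteq> 0"
begin

lemma m_pos: "m > 0"
proof -
  have "card {0 :: 'a, 1} \<le> CARD('a)" by (intro card_mono) auto
  then show ?thesis using card_field by simp
qed

lemma w_cubed: "w ^ 3 = 1"
  using w by algebra

lemma w_neq: "w \<noteq> 0" "w \<noteq> 1" "w\<^sup>2 \<noteq> 0" "w\<^sup>2 \<noteq> 1" "w \<noteq> w\<^sup>2"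
proof -
  show w0: "w \<noteq> 0" using w by auto
  show w1: "w \<noteq> 1" using w three by auto
  show "w\<^sup>2 \<noteq> 0" using w0 by simp
  show "w\<^sup>2 \<noteq> 1" using w_cubed w1 by (metis mult_1 power2_eq_square power3_eq_cube)
  show "w \<noteq> w\<^sup>2" using w0 w1 by (simp add: power2_eq_square)
qed

lemma power_3m: "x \<noteq> 0 \<Longrightarrow> x ^ (3 * m) = 1" for x :: 'a
  using power_card_minus_1[of x] card_field by simp

lemma power_m_cases: "x ^ m \<in> {0, 1, w, w\<^sup>2}" for x :: 'a
proof (cases "x = 0")
  case True
  then show ?thesis using m_pos by simp
next
  case False
  then have "(x ^ m) ^ 3 = 1" using power_3m[OF False] by (simp add: mult.commute flip: power_mult)
  moreover have "(y - 1) * (y - w) * (y - w\<^sup>2) = 0" if "y ^ 3 = 1" for y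
    using w that by algebra
  ultimately have "(x ^ m - 1) * (x ^ m - w) * (x ^ m - w\<^sup>2) = 0" by blast
  then show ?thesis by auto
qed

lemma card_cube_roots_cube:
  assumes "(z :: 'a) \<noteq> 0"
  shows "card {y. y ^ 3 = z ^ 3} = 3"
proof -
  have "y \<in> {z, z * w, z * w\<^sup>2}" if "y ^ 3 = z ^ 3" for y
  proof -
    have "(y - z) * (y - z * w) * (y - z * w\<^sup>2) = 0" using w that by algebra
    then show ?thesis by auto
  qed
  moreover have "(z * w) ^ 3 = z ^ 3" "(z * w\<^sup>2) ^ 3 = z ^ 3" using w_cubed by algebra+
  ultimately have "{y. y ^ 3 = z ^ 3} = {z, z * w, z * w\<^sup>2}" by auto
  then show ?thesis using w_neq assms by (simp add: card_insert_if)
qed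

text \<open>Cubing is three-to-one on the \<open>3 * m\<close> nonzero elements, so there are
  \<open>m\<close> nonzero cubes. All are roots of X^m - 1, which has at most \<open>m\<close>
  roots.\<close>

lemma cube_iff:
  assumes "(u :: 'a) \<noteq> 0"
  shows "u ^ m = 1 \<longleftrightarrow> (\<exists>y. y ^ 3 = u)"
proof -
  define C where "C = (\<lambda>y :: 'a. y ^ 3) ` (UNIV - {0})"
  have fib: "card {y \<in> UNIV - {0}. y ^ 3 = u} = 3" if "u \<in> C" for u
  proof -
    obtain z where z: "z \<noteq> 0" "u = z ^ 3" using \<open>u \<in> C\<close> by (auto simp: C_def)
    then have "{y \<in> UNIV - {0}. y ^ 3 = u} = {y. y ^ 3 = z ^ 3}" by auto
    then show ?thesis using card_cube_roots_cube[OF z(1)] by simp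
  qed
  have "card (UNIV - {0 :: 'a}) = (\<Sum>y\<in>UNIV - {0 :: 'a}. 1)" by simp
  also have "\<dots> = (\<Sum>u\<in>C. of_nat (card {y \<in> UNIV - {0}. y ^ 3 = u}) * 1)"
    by (rule sum_fun_comp[where g = "\<lambda>y. y ^ 3" and f = "\<lambda>_. 1"]) (auto simp: C_def)
  also have "\<dots> = 3 * card C" using fib by simp
  finally have "card C = m" using card_field by (simp add: card_Diff_singleton)
  moreover have sub: "C \<subseteq> {x. x ^ m = 1}"
    using power_3m by (auto simp: C_def simp flip: power_mult)
  ultimately have "C = {x. x ^ m = 1}"
    using card_power_eq_1_le[OF m_pos, where 'a = 'a] by (intro card_seteq) auto
  moreover have "u \<in> C \<longleftrightarrow> (\<exists>y. y ^ 3 = u)" using assms by (auto simp: C_def)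
  ultimately show ?thesis by blast
qed

text \<open>The last branch is meant for \<open>w\<^sup>2\<close>; by \<open>power_m_cases\<close>
  no other value reaches it from an \<open>m\<close>-th power.\<close>

definition chi_val :: "'a \<Rightarrow> complex" where
  "chi_val y = (if y = 0 then 0 else if y = 1 then 1 else if y = w then omega else omega\<^sup>2)"

definition chi :: "'a \<Rightarrow> complex" where
  "chi x = chi_val (x ^ m)"

lemma chi_val_simps [simp]:
  "chi_val 0 = 0" "chi_val 1 = 1" "chi_val w = omega" "chi_val (w\<^sup>2) = omega\<^sup>2"
  using w_neq by (auto simp: chi_val_def)

lemma chi_0 [simp]: "chi 0 = 0"
  using m_pos by (simp add: chi_def zero_power)

lemma chi_1 [simp]: "chi 1 = 1"
  by (simp add: chi_def)

text \<open>Taking \<open>m\<close>-th powers is multiplicative, and \<open>chi_val\<close> respects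
  the multiplication table of the four possible values.\<close>

lemma chi_mult: "chi (x * y) = chi x * chi y"
proof -
  have w4: "w * w\<^sup>2 = 1" "w\<^sup>2 * w = 1" "w ^ 4 = w" "w * w = w\<^sup>2"
    using w_cubed by (auto simp: power2_eq_square power3_eq_cube power4_eq_xxxx mult.assoc)
  have o4: "omega * omega\<^sup>2 = 1" "omega\<^sup>2 * omega = 1" "omega ^ 4 = omega"
    "omega * omega = omega\<^sup>2"
    using omega_cubed by (auto simp: power2_eq_square power3_eq_cube power4_eq_xxxx mult.assoc)
  have "chi_val (a * b) = chi_val a * chi_val b"
    if "a \<in> {0, 1, w, w\<^sup>2}" "b \<in> {0, 1, w, w\<^sup>2}" for a b
    using that by (elim insertE emptyE) (simp_all add: w4 o4)
  then show ?thesis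
    using power_m_cases[of x] power_m_cases[of y] by (simp only: chi_def power_mult_distrib)
qed

lemma chi_cube: "x \<noteq> 0 \<Longrightarrow> chi (x ^ 3) = 1"
  using power_3m by (simp add: chi_def flip: power_mult)

lemma chi_minus: "chi (- x) = chi x"
proof -
  have "chi (- 1) = chi ((- 1) ^ 3)" by simp
  also have "\<dots> = 1" by (rule chi_cube) simp
  finally show ?thesis using chi_mult[of "- 1" x] by simp
qed

lemma cnj_chi: "cnj (chi x) = (chi x)\<^sup>2"
proof -
  have "cnj (omega\<^sup>2) = (omega\<^sup>2)\<^sup>2"
    by (simp only: complex_cnj_power cnj_omega)
  moreover have "cnj (chi_val a) = (chi_val a)\<^sup>2" if "a \<in> {0, 1, w, w\<^sup>2}" for a
    using that calculation by (elim insertE emptyE) (simp_all add: cnj_omega)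
  ultimately show ?thesis using power_m_cases[of x] by (simp only: chi_def)
qed

lemma chi_cubed: "x \<noteq> 0 \<Longrightarrow> chi x ^ 3 = 1"
  using chi_cube[of x] by (simp add: power3_eq_cube chi_mult)

lemma chi_mult_cnj: "x \<noteq> 0 \<Longrightarrow> chi x * cnj (chi x) = 1"
  using chi_cubed[of x] by (simp add: cnj_chi power2_eq_square power3_eq_cube mult.assoc)

lemma sum_chi: "(\<Sum>x\<in>UNIV. chi x) = 0"
proof -
  obtain z :: 'a where z: "z \<noteq> 0" "z ^ m \<noteq> 1"
    using ex_power_neq_1[of m, where 'a = 'a] card_field m_pos by auto
  have "omega\<^sup>2 \<noteq> 1" using omega_cubed omega_neq_1 by (metis mult_1 power2_eq_square power3_eq_cube)
  then have "chi z \<noteq> 1" using z omega_neq_1 by (auto simp: chi_def chi_val_def)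
  moreover have "(\<Sum>x\<in>UNIV. chi x) = chi z * (\<Sum>x\<in>UNIV. chi x)"
    using sum_scale_field[OF z(1), of chi] by (simp add: chi_mult sum_distrib_left)
  ultimately show ?thesis by auto
qed

text \<open>For nonzero \<open>u\<close> the right-hand side sums the powers of a cube root of
  unity: 3 at cubes, 0 elsewhere. At \<open>u = 0\<close> the character terms vanish and 1 remains
  for the single root.\<close>

lemma card_cube_roots: "of_nat (card {x. x ^ 3 = u}) = 1 + chi u + cnj (chi u)"
proof (cases "u = 0")
  case True
  then show ?thesis by simp
next
  case False
  show ?thesis
  proof (cases "u ^ m = 1")
    case True
    then obtain z where z: "z ^ 3 = u" "z \<noteq> 0" using cube_iff[OF False] False by auto
    then have "card {y. y ^ 3 = u} = 3" using card_cube_roots_cube by auto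
    then show ?thesis using True by (simp add: chi_def)
  next
    case nc: False
    then have e: "{x. x ^ 3 = u} = {}" using cube_iff[OF False] by auto
    have "chi u = omega \<or> chi u = omega\<^sup>2" using nc False by (auto simp: chi_def chi_val_def)
    moreover have "(omega\<^sup>2)\<^sup>2 = omega" using omega_cubed by algebra
    ultimately have "1 + chi u + (chi u)\<^sup>2 = 0" using omega_sum by (auto simp: add_ac)
    then show ?thesis unfolding e by (simp add: cnj_chi)
  qed
qed

text \<open>\<open>conv 1\<close> is the Jacobi sum of \<open>chi\<close> with itself.\<close>
definition conv :: "'a \<Rightarrow> complex" where
  "conv u = (\<Sum>x\<in>UNIV. chi x * chi (u - x))"

text \<open>The autocorrelation of \<open>chi\<close>, which arises both in the absolute value of
  the Jacobi sum and in the mixed terms of the point count.\<close>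

definition corr :: "'a \<Rightarrow> complex" where
  "corr v = (\<Sum>z\<in>UNIV. chi (z + v) * cnj (chi z))"

lemma conv_0: "conv 0 = 0"
proof -
  have "conv 0 = (\<Sum>x\<in>UNIV. cnj (chi x))"
    by (simp add: conv_def chi_minus cnj_chi power2_eq_square)
  also have "\<dots> = cnj (\<Sum>x\<in>UNIV. chi x)" by simp
  finally show ?thesis by (simp only: sum_chi complex_cnj_zero)
qed

text \<open>Substituting \<open>u * x\<close> for \<open>x\<close> extracts the square of
  \<open>chi u\<close>, which is its conjugate.\<close>

lemma conv_scale: "conv u = cnj (chi u) * conv 1"
proof (cases "u = 0")
  case True
  then show ?thesis by (simp add: conv_0)
next
  case False
  have "conv u = (\<Sum>x\<in>UNIV. chi (u * x) * chi (u - u * x))"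
    unfolding conv_def by (rule sum_scale_field[OF False, symmetric])
  also have "\<dots> = (\<Sum>x\<in>UNIV. cnj (chi u) * (chi x * chi (1 - x)))"
  proof (rule sum.cong)
    fix x
    have "u - u * x = u * (1 - x)" by (simp add: algebra_simps)
    then show "chi (u * x) * chi (u - u * x) = cnj (chi u) * (chi x * chi (1 - x))"
      by (simp add: chi_mult cnj_chi power2_eq_square)
  qed simp
  finally show ?thesis by (simp add: conv_def sum_distrib_left)
qed

lemma corr_0: "corr 0 = of_nat (3 * m)"
proof -
  have "corr 0 = (\<Sum>z\<in>UNIV - {0 :: 'a}. 1)"
    unfolding corr_def by (rule sum.mono_neutral_cong_right) (auto simp: chi_mult_cnj)
  then show ?thesis using card_field by (simp add: card_Diff_singleton)
qed

lemma corr_eq_corr_1: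
  assumes "v \<noteq> 0"
  shows "corr v = corr 1"
proof -
  have "corr v = (\<Sum>z\<in>UNIV. chi (v * z + v) * cnj (chi (v * z)))"
    unfolding corr_def by (rule sum_scale_field[OF assms, symmetric])
  also have "\<dots> = (\<Sum>z\<in>UNIV. chi (z + 1) * cnj (chi z))"
  proof (rule sum.cong)
    fix z
    have "v * z + v = v * (z + 1)" by (simp add: algebra_simps)
    then have "chi (v * z + v) * cnj (chi (v * z)) = (chi v * cnj (chi v)) * (chi (z + 1) * cnj (chi z))"
      by (simp add: chi_mult)
    then show "chi (v * z + v) * cnj (chi (v * z)) = chi (z + 1) * cnj (chi z)"
      using chi_mult_cnj[OF assms] by simp
  qed simp
  finally show ?thesis by (simp add: corr_def)
qed

lemma sum_corr: "(\<Sum>v\<in>UNIV. corr v) = 0"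
proof -
  have "(\<Sum>v\<in>UNIV. corr v) = (\<Sum>z\<in>UNIV. \<Sum>v\<in>UNIV. chi (v + z) * cnj (chi z))"
    unfolding corr_def by (subst sum.swap) (simp add: add.commute)
  also have "\<dots> = (\<Sum>z\<in>UNIV. (\<Sum>v\<in>UNIV. chi v) * cnj (chi z))"
    unfolding sum_distrib_right[symmetric] by (subst sum_shift_field) (rule refl)
  finally show ?thesis by (simp add: sum_chi)
qed

lemma sum_UNIV_nonzero: "(\<Sum>x\<in>UNIV. f x) = f 0 + (\<Sum>x\<in>UNIV - {0 :: 'a}. f x)"
  for f :: "'a \<Rightarrow> complex"
  by (rule sum.remove) auto

text \<open>The values of \<open>corr\<close> sum to 0; one of them is \<open>3 * m\<close> and the
  other \<open>3 * m\<close> are equal.\<close>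

lemma corr_1: "corr 1 = -1"
proof -
  have "0 = corr 0 + (\<Sum>v\<in>UNIV - {0 :: 'a}. corr 1)"
  proof -
    have "(\<Sum>v\<in>UNIV - {0}. corr v) = (\<Sum>v\<in>UNIV - {0 :: 'a}. corr 1)"
      by (rule sum.cong[OF refl], rule corr_eq_corr_1) simp
    then show ?thesis using sum_corr sum_UNIV_nonzero[of corr] by metis
  qed
  also have "\<dots> = of_nat (3 * m) * (1 + corr 1)"
    using card_field by (simp add: corr_0 card_Diff_singleton algebra_simps)
  finally have "1 + corr 1 = 0" using m_pos by simp
  then show ?thesis by (simp add: add_eq_0_iff)
qed

text \<open>The sum of \<open>\<chi>(x) \<chi>(y) \<chi>\<^bsup>-1\<^esup>(z) \<chi>\<^bsup>-1\<^esup>(y')\<close> over \<open>x + y = z + y'\<close> is evaluated in two ways, by fixing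
  \<open>x + y\<close> and by fixing \<open>x - z\<close>.\<close>
lemma norm_conv_1: "conv 1 * cnj (conv 1) = of_nat CARD('a)"
proof -
  have "(\<Sum>u\<in>UNIV. conv u * cnj (conv u)) = of_nat (3 * m) * (conv 1 * cnj (conv 1))"
  proof -
    have "(\<Sum>u\<in>UNIV. conv u * cnj (conv u)) = (\<Sum>u\<in>UNIV - {0 :: 'a}. conv 1 * cnj (conv 1))"
    proof (rule sum.mono_neutral_cong_right)
      fix u :: 'a assume "u \<in> UNIV - {0}"
      then have "chi u * cnj (chi u) = 1" using chi_mult_cnj by simp
      then show "conv u * cnj (conv u) = conv 1 * cnj (conv 1)"
        by (subst (1 2) conv_scale) (simp add: algebra_simps)
    qed (auto simp: conv_0)
    then show ?thesis using card_field by (simp add: card_Diff_singleton)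
  qed
  moreover have "(\<Sum>u\<in>UNIV. conv u * cnj (conv u)) = (\<Sum>v\<in>UNIV. corr v * cnj (corr v))"
  proof -
    have "(\<Sum>u\<in>UNIV. conv u * cnj (conv u))
        = (\<Sum>u\<in>UNIV. \<Sum>x\<in>UNIV. \<Sum>z\<in>UNIV. chi x * chi (u - x) * (cnj (chi z) * cnj (chi (u - z))))"
      by (simp add: conv_def sum_product)
    also have "\<dots> = (\<Sum>u\<in>UNIV. \<Sum>z\<in>UNIV. \<Sum>x\<in>UNIV. chi x * chi (u - x) * (cnj (chi z) * cnj (chi (u - z))))"
      by (rule sum.cong[OF refl], rule sum.swap)
    also have "\<dots> = (\<Sum>z\<in>UNIV. \<Sum>u\<in>UNIV. \<Sum>x\<in>UNIV. chi x * chi (u - x) * (cnj (chi z) * cnj (chi (u - z))))"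
      by (rule sum.swap)
    \<comment> \<open>Put x = v + z, so that \<open>v\<close> is the difference to be fixed.\<close>
    also have "\<dots> = (\<Sum>z\<in>UNIV. \<Sum>u\<in>UNIV. \<Sum>v\<in>UNIV. chi (v + z) * chi (u - (v + z)) * (cnj (chi z) * cnj (chi (u - z))))"
      by (rule sum.cong[OF refl], rule sum.cong[OF refl], rule sum_shift_field[symmetric])
    also have "\<dots> = (\<Sum>z\<in>UNIV. \<Sum>v\<in>UNIV. \<Sum>u\<in>UNIV. chi (v + z) * chi (u - (v + z)) * (cnj (chi z) * cnj (chi (u - z))))"
      by (rule sum.cong[OF refl], rule sum.swap)
    \<comment> \<open>Put u = y + (v + z): the factors containing \<open>u\<close> become those at
      \<open>y\<close> and at \<open>y + v\<close>, and the sum splits into two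
      correlations.\<close>
    also have "\<dots> = (\<Sum>z\<in>UNIV. \<Sum>v\<in>UNIV. \<Sum>y\<in>UNIV. chi (v + z) * chi (y + (v + z) - (v + z)) * (cnj (chi z) * cnj (chi (y + (v + z) - z))))"
      by (rule sum.cong[OF refl], rule sum.cong[OF refl], rule sum_shift_field[symmetric])
    also have "\<dots> = (\<Sum>v\<in>UNIV. \<Sum>z\<in>UNIV. \<Sum>y\<in>UNIV. (chi (z + v) * cnj (chi z)) * cnj (chi (y + v) * cnj (chi y)))"
      by (subst sum.swap) (simp add: algebra_simps)
    also have "\<dots> = (\<Sum>v\<in>UNIV. corr v * cnj (corr v))"
      by (simp add: corr_def sum_product)
    finally show ?thesis .
  qed
  moreover have "(\<Sum>v\<in>UNIV. corr v * cnj (corr v)) = of_nat (3 * m) * of_nat (3 * m + 1)"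
  proof -
    have "(\<Sum>v\<in>UNIV. corr v * cnj (corr v)) = corr 0 * cnj (corr 0) + (\<Sum>v\<in>UNIV - {0 :: 'a}. 1)"
      by (subst sum_UNIV_nonzero) (simp add: corr_eq_corr_1 corr_1)
    also have "\<dots> = of_nat (3 * m) * of_nat (3 * m + 1)"
      using card_field by (simp add: corr_0 card_Diff_singleton algebra_simps)
    finally show ?thesis .
  qed
  ultimately have "of_nat (3 * m) * (conv 1 * cnj (conv 1)) = (of_nat (3 * m) * of_nat (3 * m + 1) :: complex)"
    by metis
  then show ?thesis using m_pos card_field by simp
qed

section \<open>Counting solutions of diagonal cubic equations\<close>

lemma chi_divide: "a \<noteq> 0 \<Longrightarrow> chi (s / a) = chi s * cnj (chi a)"
  using chi_mult[of "s / a" a] chi_mult_cnj[of a] by (simp add: mult.assoc)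

text \<open>Multiply the two expansions from \<open>card_cube_roots\<close> and sum over the value
  \<open>s\<close> of the first term. Single characters sum to 0, products of like characters give
  \<open>conv\<close>, mixed ones give \<open>corr\<close>.\<close>

lemma card_binary_cubic:
  assumes a: "a1 \<noteq> 0" "a2 \<noteq> 0"
  shows "complex_of_nat (card {(x, y). a1 * x ^ 3 + a2 * y ^ 3 = t}) = of_nat CARD('a)
      + (cnj (chi (a1 * a2)) * conv t + cnj (cnj (chi (a1 * a2)) * conv t))
      + (cnj (chi a1) * chi a2 * corr (- t) + cnj (cnj (chi a1) * chi a2 * corr (- t)))"
proof -
  define b1 where "b1 = cnj (chi a1)"
  define b2 where "b2 = cnj (chi a2)"
  have N: "of_nat (card {x. a * x ^ 3 = s}) = 1 + chi s * cnj (chi a) + cnj (chi s * cnj (chi a))"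
    if "a \<noteq> 0" for a s
  proof -
    have "{x. a * x ^ 3 = s} = {x. x ^ 3 = s / a}" using that by (auto simp: field_simps)
    then show ?thesis by (simp only: card_cube_roots chi_divide[OF that])
  qed
  \<comment> \<open>Reflect \<open>s\<close> to \<open>t - z\<close> and use that \<open>chi\<close>
    is even.\<close>
  have corr: "(\<Sum>s\<in>UNIV. chi s * cnj (chi (t - s))) = corr (- t)"
  proof -
    have "(\<Sum>s\<in>UNIV. chi s * cnj (chi (t - s))) = (\<Sum>z\<in>UNIV. chi (t - z) * cnj (chi (t - (t - z))))"
      by (rule sum_reflect_field[symmetric])
    also have "\<dots> = corr (- t)"
      unfolding corr_def by (rule sum.cong) (use chi_minus[of "t - _"] in auto)
    finally show ?thesis .
  qed
  have T: "(\<Sum>s\<in>UNIV. chi (t - s)) = 0" using sum_reflect_field[of chi t] sum_chi by simp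
  have "complex_of_nat (card {(x, y). a1 * x ^ 3 + a2 * y ^ 3 = t})
      = (\<Sum>s\<in>UNIV. (1 + chi s * b1 + cnj (chi s * b1)) * (1 + chi (t - s) * b2 + cnj (chi (t - s) * b2)))"
    unfolding card_sum_eq_convolution of_nat_sum of_nat_mult N[OF a(1)] N[OF a(2)] b1_def b2_def ..
  also have "\<dots> = (\<Sum>s\<in>UNIV. 1 + b1 * chi s + cnj (b1 * chi s) + b2 * chi (t - s) + cnj (b2 * chi (t - s))
        + b1 * b2 * (chi s * chi (t - s)) + cnj (b1 * b2 * (chi s * chi (t - s)))
        + b1 * cnj b2 * (chi s * cnj (chi (t - s))) + cnj (b1 * cnj b2 * (chi s * cnj (chi (t - s)))))"
    by (rule sum.cong) (simp_all add: algebra_simps)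
  also have "\<dots> = of_nat CARD('a) + b1 * (\<Sum>s\<in>UNIV. chi s) + cnj (b1 * (\<Sum>s\<in>UNIV. chi s))
        + b2 * (\<Sum>s\<in>UNIV. chi (t - s)) + cnj (b2 * (\<Sum>s\<in>UNIV. chi (t - s)))
        + b1 * b2 * conv t + cnj (b1 * b2 * conv t)
        + b1 * cnj b2 * corr (- t) + cnj (b1 * cnj b2 * corr (- t))"
    unfolding corr[symmetric] conv_def sum_distrib_left sum.distrib cnj_sum by simp
  finally show ?thesis by (simp add: sum_chi T b1_def b2_def chi_mult algebra_simps)
qed

text \<open>Fix the third variable and count the other two. Cubes are invisible to
  \<open>chi\<close>, so all nonzero values of that variable contribute equally.\<close>

lemma card_cubic_zeros:
  assumes a: "a1 \<noteq> 0" "a2 \<noteq> 0" "a3 \<noteq> 0"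
  shows "complex_of_nat (card (cubic_zeros a1 a2 a3)) = (of_nat CARD('a))\<^sup>2
    + of_nat (3 * m) * (cnj (chi (a1 * a2 * a3)) * conv 1 + cnj (cnj (chi (a1 * a2 * a3)) * conv 1))"
proof -
  define z where "z x = - (a3 * x ^ 3)" for x
  define S where "S x = {(x1, x2). a1 * x1 ^ 3 + a2 * x2 ^ 3 = z x}" for x
  have "bij_betw (\<lambda>(x1, x2, x3). (x3, x1, x2)) (cubic_zeros a1 a2 a3) (Sigma UNIV S)"
    by (rule bij_betw_byWitness[where f' = "\<lambda>(x3, x1, x2). (x1, x2, x3)"])
       (auto simp: cubic_zeros_def S_def z_def eq_neg_iff_add_eq_0)
  then have "card (cubic_zeros a1 a2 a3) = card (Sigma UNIV S)" by (rule bij_betw_same_card)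
  also have "\<dots> = (\<Sum>x\<in>UNIV. card (S x))" by (simp add: card_SigmaI)
  finally have "complex_of_nat (card (cubic_zeros a1 a2 a3)) = (\<Sum>x\<in>UNIV. of_nat (card (S x)))" by simp
  also have "\<dots> = (\<Sum>x\<in>UNIV. of_nat CARD('a)
      + (cnj (chi (a1 * a2)) * conv (z x) + cnj (cnj (chi (a1 * a2)) * conv (z x)))
      + (cnj (chi a1) * chi a2 * corr (- z x) + cnj (cnj (chi a1) * chi a2 * corr (- z x))))"
    unfolding S_def card_binary_cubic[OF a(1,2)] ..
  also have "\<dots> = (of_nat CARD('a))\<^sup>2
      + (cnj (chi (a1 * a2)) * (\<Sum>x\<in>UNIV. conv (z x)) + cnj (cnj (chi (a1 * a2)) * (\<Sum>x\<in>UNIV. conv (z x))))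
      + (cnj (chi a1) * chi a2 * (\<Sum>x\<in>UNIV. corr (- z x)) + cnj (cnj (chi a1) * chi a2 * (\<Sum>x\<in>UNIV. corr (- z x))))"
    unfolding sum.distrib sum_distrib_left cnj_sum by (simp add: power2_eq_square)
  \<comment> \<open>The value \<open>3 * m\<close> at 0 cancels against \<open>3 * m\<close> values
    -1.\<close>
  also have "(\<Sum>x\<in>UNIV. corr (- z x)) = 0"
  proof -
    have "(\<Sum>x\<in>UNIV. corr (- z x)) = corr 0 + (\<Sum>x\<in>UNIV - {0 :: 'a}. -1)"
      unfolding sum_UNIV_nonzero[of "\<lambda>x. corr (- z x)"] using a(3)
      by (intro arg_cong2[where f = "(+)"] sum.cong) (simp_all add: z_def corr_eq_corr_1 corr_1)
    then show ?thesis using card_field by (simp add: corr_0 card_Diff_singleton)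
  qed
  also have "(\<Sum>x\<in>UNIV. conv (z x)) = of_nat (3 * m) * (cnj (chi a3) * conv 1)"
  proof -
    have "conv (z x) = cnj (chi a3) * conv 1" if "x \<noteq> 0" for x
      by (subst conv_scale) (use that in \<open>simp add: z_def chi_minus chi_mult chi_cube\<close>)
    then have "(\<Sum>x\<in>UNIV. conv (z x)) = (\<Sum>x\<in>UNIV - {0 :: 'a}. cnj (chi a3) * conv 1)"
      unfolding sum_UNIV_nonzero[of "\<lambda>x. conv (z x)"] by (simp add: z_def conv_0)
    then show ?thesis using card_field by (simp add: card_Diff_singleton)
  qed
  finally show ?thesis by (simp add: chi_mult algebra_simps)
qed

section \<open>Arithmetic of the Jacobi sum\<close>

definition fibre :: "'a \<Rightarrow> nat" where
  "fibre e = card {x. (x * (1 - x)) ^ m = e}"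

text \<open>The target ring is arbitrary because the same counts are needed for the complex Jacobi
  sum and for its reductions in the field, where \<open>f\<close> is the identity or
  squaring.\<close>

lemma sum_fibre:
  fixes f :: "'a \<Rightarrow> 'b::comm_ring_1"
  assumes "f 0 = 0"
  shows "(\<Sum>x\<in>UNIV. f ((x * (1 - x)) ^ m))
    = of_nat (fibre 1) * f 1 + of_nat (fibre w) * f w + of_nat (fibre (w\<^sup>2)) * f (w\<^sup>2)"
proof -
  have "(\<Sum>x\<in>UNIV. f ((x * (1 - x)) ^ m))
      = (\<Sum>y\<in>{0, 1, w, w\<^sup>2}. of_nat (card {x \<in> UNIV. (x * (1 - x)) ^ m = y}) * f y)"
    by (rule sum_fun_comp) (simp, simp, rule image_subsetI, rule power_m_cases)
  then show ?thesis using w_neq assms by (simp add: fibre_def add_ac)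
qed

lemma conv_1_eq: "conv 1 = of_nat (fibre 1) + of_nat (fibre w) * omega + of_nat (fibre (w\<^sup>2)) * omega\<^sup>2"
  using sum_fibre[of chi_val] by (simp add: conv_def flip: chi_mult) (simp add: chi_def)

lemma sum_power_less: "n < 3 * m \<Longrightarrow> (\<Sum>x\<in>UNIV. x ^ n :: 'a) = 0"
  using sum_power_field[of n, where 'a = 'a] card_field by (auto dest: dvd_imp_le)

lemma sum_power_3m: "(\<Sum>x\<in>UNIV. x ^ (3 * m) :: 'a) = -1"
  using sum_power_field[of "3 * m", where 'a = 'a] card_field m_pos by simp

lemma sum_prod_power:
  "(\<Sum>x::'a\<in>UNIV. (x * (1 - x)) ^ n) = (\<Sum>j\<le>n. of_nat (n choose j) * (- 1) ^ j * (\<Sum>x\<in>UNIV. x ^ (n + j)))"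
proof -
  have "(x * (1 - x)) ^ n = (\<Sum>j\<le>n. of_nat (n choose j) * (- 1) ^ j * x ^ (n + j))" for x :: 'a
  proof -
    have "(1 - x) ^ n = (- x + 1) ^ n" by simp
    also have "\<dots> = (\<Sum>j\<le>n. of_nat (n choose j) * (- x) ^ j * 1 ^ (n - j))" by (rule binomial_ring)
    finally show ?thesis
      unfolding power_mult_distrib
      by (simp add: sum_distrib_left power_add mult_ac power_minus[of x])
  qed
  then show ?thesis by (simp add: sum.swap[of _ UNIV] sum_distrib_left)
qed

text \<open>The left-hand side is the Jacobi sum with \<open>omega\<close> replaced by
  \<open>w\<close>. Expanding gives power sums with exponents from \<open>m\<close> to
  \<open>2 * m\<close>, all below q - 1.\<close>

lemma fibre_sum_w: "of_nat (fibre 1) + of_nat (fibre w) * w + of_nat (fibre (w\<^sup>2)) * w\<^sup>2 = 0"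
proof -
  have "(\<Sum>x::'a\<in>UNIV. (x * (1 - x)) ^ m) = 0"
    unfolding sum_prod_power using m_pos by (intro sum.neutral) (auto simp: sum_power_less)
  then show ?thesis using sum_fibre[of "\<lambda>y. y"] by simp
qed

text \<open>The reduction of the conjugate Jacobi sum. Now the exponents run from
  \<open>2 * m\<close> to \<open>4 * m\<close>, and only \<open>3 * m\<close>, reached at
  \<open>j = m\<close>, gives a nonzero power sum.\<close>

lemma fibre_sum_w2: "of_nat (fibre 1) + of_nat (fibre w) * w\<^sup>2 + of_nat (fibre (w\<^sup>2)) * w
    = - ((- 1) ^ m * of_nat (2 * m choose m))"
proof -
  have z: "(\<Sum>x\<in>UNIV. x ^ (2 * m + j) :: 'a) = 0" if "j \<le> 2 * m" "j \<noteq> m" for j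
  proof -
    have "\<not> 3 * m dvd 2 * m + j"
    proof
      assume "3 * m dvd 2 * m + j"
      then obtain i where i: "2 * m + j = 3 * m * i" by blast
      have "i \<noteq> 0" using i m_pos by (intro notI) simp
      moreover have "i \<noteq> 1" using i that(2) by auto
      ultimately have "3 * m * 2 \<le> 3 * m * i" by (intro mult_le_mono2) simp
      then show False unfolding i[symmetric] using that(1) m_pos by simp
    qed
    then show ?thesis using sum_power_field[of "2 * m + j", where 'a = 'a] card_field by simp
  qed
  have "(\<Sum>x::'a\<in>UNIV. (x * (1 - x)) ^ (2 * m))
      = (\<Sum>j\<in>{m}. of_nat (2 * m choose j) * (- 1) ^ j * (\<Sum>x\<in>UNIV. x ^ (2 * m + j)))"
    unfolding sum_prod_power by (rule sum.mono_neutral_right) (auto simp: z)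
  also have "\<dots> = - ((- 1) ^ m * of_nat (2 * m choose m))"
    using sum_power_3m by (simp add: mult.commute)
  finally have "(\<Sum>x::'a\<in>UNIV. ((x * (1 - x)) ^ m)\<^sup>2) = - ((- 1) ^ m * of_nat (2 * m choose m))"
    by (simp add: mult.commute flip: power_mult)
  moreover have "(w\<^sup>2)\<^sup>2 = w" using w_cubed by algebra
  ultimately show ?thesis using sum_fibre[of "\<lambda>y. y\<^sup>2"] by simp
qed

text \<open>The map \<open>x \<mapsto> 1 / (1 - x)\<close> has order 3 and changes \<open>x (1 - x)\<close> by a cube; its fixed points
  \<open>- w\<close> and \<open>- w\<^sup>2\<close> satisfy \<open>x (1 - x) = 1\<close>.\<close>
lemma fibre_mod_3:
  "3 dvd fibre w" "3 dvd fibre (w\<^sup>2)" "[fibre 1 = 2] (mod 3)"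
proof -
  define T where "T x = 1 / (1 - x)" for x :: 'a
  define A where "A e = {x :: 'a. (x * (1 - x)) ^ m = e}" for e
  have m1: "(- 1 :: 'a) ^ m = 1"
    using power_3m[of "- 1"] by (simp add: power_mult)
  \<comment> \<open>This keeps \<open>T\<close> away from 1, where it takes the default value
    \<open>1 / 0 = 0\<close>.\<close>
  have ne: "x \<noteq> 0 \<and> x \<noteq> 1" if "x \<in> A e" "e \<noteq> 0" for x e
    using that m_pos by (auto simp: A_def zero_power)
  have TA: "T x \<in> A e \<and> T (T (T x)) = x" if x: "x \<in> A e" "e \<noteq> 0" for x e
  proof
    have n: "1 - x \<noteq> 0" "x \<noteq> 0" using ne[OF x] by auto
    \<comment> \<open>Both (1 - x)^3 and -1 are cubes, so their \<open>m\<close>-th powers are 1 and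
      \<open>T\<close> preserves each fibre.\<close>
    have "T x * (1 - T x) * (1 - x) ^ 3 = (- 1) * (x * (1 - x))"
    proof -
      have "1 - T x = - x / (1 - x)" using n by (simp add: T_def field_simps)
      then show ?thesis using n by (simp add: T_def power3_eq_cube)
    qed
    then have "(T x * (1 - T x)) ^ m * ((1 - x) ^ 3) ^ m = (- 1) ^ m * (x * (1 - x)) ^ m"
      by (metis power_mult_distrib)
    moreover have "((1 - x) ^ 3) ^ m = 1" using power_3m[OF n(1)] by (simp add: power_mult)
    ultimately show "T x \<in> A e" using x m1 by (simp add: A_def)
    have "1 - T x = - x / (1 - x)" using n by (simp add: T_def field_simps)
    then have "T (T x) = - ((1 - x) / x)" unfolding T_def[of "T x"] by simp
    then have "1 - T (T x) = 1 / x" using n by (simp only:) (simp add: field_simps)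
    then show "T (T (T x)) = x" unfolding T_def[of "T (T x)"] by simp
  qed
  \<comment> \<open>The fixed points are the roots of x^2 - x + 1, the primitive sixth roots of
    unity.\<close>
  have fix1: "x \<in> {- w, - (w\<^sup>2)}" if "T x = x" "x \<noteq> 1" for x
  proof -
    have "1 = x * (1 - x)" using that by (simp add: T_def field_simps)
    then have "(x + w) * (x + w\<^sup>2) = 0" using w by algebra
    then show ?thesis by (auto simp: eq_neg_iff_add_eq_0)
  qed
  have fix2: "x * (1 - x) = 1 \<and> T x = x" if "x \<in> {- w, - (w\<^sup>2)}" for x
  proof -
    have e: "x * (1 - x) = 1" using that w w_cubed by (elim insertE emptyE) (simp, algebra)+
    then have "1 - x \<noteq> 0" by auto
    then show ?thesis using e by (simp add: T_def field_simps)
  qed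
  have nonfix: "3 dvd card {x \<in> A e. T x \<noteq> x}" if "e \<noteq> 0" for e
    by (rule three_dvd_card_nonfixed_points) (use TA that in auto)
  \<comment> \<open>A fixed point has x (1 - x) = 1, so it lies in \<open>A 1\<close> and in no
    other fibre.\<close>
  have "{x \<in> A e. T x \<noteq> x} = A e" if "e \<noteq> 0" "e \<noteq> 1" for e
  proof -
    have False if "x \<in> A e" "T x = x" for x
      using fix2[OF fix1[OF that(2)]] ne[OF that(1) \<open>e \<noteq> 0\<close>] that(1) \<open>e \<noteq> 1\<close> by (auto simp: A_def)
    then show ?thesis by auto
  qed
  then show "3 dvd fibre w" "3 dvd fibre (w\<^sup>2)"
    using nonfix[of w] nonfix[of "w\<^sup>2"] w_neq by (simp_all add: fibre_def A_def)
  have "A 1 = {x \<in> A 1. T x \<noteq> x} \<union> {- w, - (w\<^sup>2)}"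
  proof -
    have "x \<in> {- w, - (w\<^sup>2)}" if "x \<in> A 1" "T x = x" for x
      using fix1[OF that(2)] ne[OF that(1)] by simp
    moreover have "{- w, - (w\<^sup>2)} \<subseteq> A 1"
    proof
      fix x assume "x \<in> {- w, - (w\<^sup>2)}"
      then show "x \<in> A 1" using fix2[of x] by (simp add: A_def)
    qed
    ultimately show ?thesis by blast
  qed
  moreover have "card ({x \<in> A 1. T x \<noteq> x} \<union> {- w, - (w\<^sup>2)}) = card {x \<in> A 1. T x \<noteq> x} + 2"
    using fix2 w_neq by (subst card_Un_disjoint) auto
  moreover have "fibre 1 = card (A 1)" by (simp add: fibre_def A_def)
  ultimately have "fibre 1 = card {x \<in> A 1. T x \<noteq> x} + 2" by metis
  moreover have "3 dvd card {x \<in> A 1. T x \<noteq> x}" using nonfix by simp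
  ultimately show "[fibre 1 = 2] (mod 3)" unfolding cong_def by presburger
qed

text \<open>All properties of one pair \<open>c\<close>, \<open>d\<close> attached to
  \<open>w\<close>. The nonvanishing of the binomial is assumed because the locale constrains only
  the size of the field, not the residue of \<open>p\<close> modulo 3.\<close>

lemma ex_norm_rep_and_card:
  assumes binom: "(of_nat (2 * m choose m) :: 'a) \<noteq> 0"
  obtains c d :: int where
    "4 * int CARD('a) = c\<^sup>2 + 27 * d\<^sup>2" "[c = 1] (mod 3)" "(of_int c :: 'a) \<noteq> 0"
    "(of_int (9 * d) :: 'a) = of_int c * (2 * w + 1)"
    "\<And>a1 a2 a3 :: 'a. a1 \<noteq> 0 \<Longrightarrow> a2 \<noteq> 0 \<Longrightarrow> a3 \<noteq> 0 \<Longrightarrow> (a1 * a2 * a3) ^ m = 1 \<Longrightarrow>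
      real (card (cubic_zeros a1 a2 a3)) = (real CARD('a))\<^sup>2 + real_of_int c * (real CARD('a) - 1)"
    "\<And>a1 a2 a3 :: 'a. a1 \<noteq> 0 \<Longrightarrow> a2 \<noteq> 0 \<Longrightarrow> a3 \<noteq> 0 \<Longrightarrow> (a1 * a2 * a3) ^ m = w \<Longrightarrow>
      real (card (cubic_zeros a1 a2 a3))
        = (real CARD('a))\<^sup>2 + 1 / 2 * (real CARD('a) - 1) * (9 * real_of_int d - real_of_int c)"
proof -
  define n0 n1 n2 where n_defs: "n0 = int (fibre 1)" "n1 = int (fibre w)" "n2 = int (fibre (w\<^sup>2))"
  obtain i j where ij: "fibre w = 3 * i" "fibre (w\<^sup>2) = 3 * j" using fibre_mod_3(1,2) by blast
  \<comment> \<open>Thus \<open>conv 1\<close> is (c + 3 d sqrt(-3)) / 2, and \<open>c\<close> is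
    its trace.\<close>
  define c where "c = 2 * n0 - n1 - n2"
  define d where "d = int i - int j"
  have d3: "3 * d = n1 - n2" using ij by (simp add: d_def n_defs)
  have J: "conv 1 = of_int n0 + of_int n1 * omega + of_int n2 * omega\<^sup>2"
    by (simp add: conv_1_eq n_defs)
  have o4: "(omega\<^sup>2)\<^sup>2 = omega" using omega_cubed by algebra
  have J': "cnj (conv 1) = of_int n0 + of_int n1 * omega\<^sup>2 + of_int n2 * omega"
    unfolding J complex_cnj_add complex_cnj_mult complex_cnj_power complex_cnj_of_int cnj_omega o4 ..
  have "of_int (4 * int CARD('a)) = 4 * (conv 1 * cnj (conv 1))"
    by (simp add: norm_conv_1)
  also have "\<dots> = of_int (c\<^sup>2 + 3 * (n1 - n2)\<^sup>2)"
    unfolding J' unfolding J c_def of_int_add of_int_mult of_int_power of_int_diff of_int_numeral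
    using omega_sum by algebra
  also have "c\<^sup>2 + 3 * (n1 - n2)\<^sup>2 = c\<^sup>2 + 27 * d\<^sup>2"
    unfolding d3[symmetric] by (simp add: power2_eq_square)
  finally have "(of_int (4 * int CARD('a)) :: complex) = of_int (c\<^sup>2 + 27 * d\<^sup>2)" .
  then have r1: "4 * int CARD('a) = c\<^sup>2 + 27 * d\<^sup>2" by (simp only: of_int_eq_iff)
  have "[n0 = 2] (mod 3)" using fibre_mod_3(3) by (simp add: n_defs flip: cong_int_iff)
  moreover have "3 dvd n1" "3 dvd n2" using ij by (simp_all add: n_defs)
  moreover have "(2 * x - y - z) mod 3 = 1" if "x mod 3 = 2" "3 dvd y" "3 dvd z" for x y z :: int
    using that by presburger
  ultimately have r2: "[c = 1] (mod 3)" by (simp add: c_def cong_def)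
  have F: "of_int n0 + of_int n1 * w + of_int n2 * w\<^sup>2 = 0"
    using fibre_sum_w by (simp add: n_defs)
  have F2: "of_int n0 + of_int n1 * w\<^sup>2 + of_int n2 * w = - ((- 1) ^ m * of_nat (2 * m choose m))"
    using fibre_sum_w2 by (simp add: n_defs)
  \<comment> \<open>In the field too \<open>c\<close> is the trace, the sum of the two reductions;
    the first is 0 and the second is the binomial up to sign.\<close>
  have "(of_int c :: 'a) = (of_int n0 + of_int n1 * w + of_int n2 * w\<^sup>2)
      + (of_int n0 + of_int n1 * w\<^sup>2 + of_int n2 * w)"
    unfolding c_def of_int_diff of_int_mult of_int_numeral using w by algebra
  then have r3: "(of_int c :: 'a) \<noteq> 0" unfolding F F2 using binom by simp
  \<comment> \<open>Twice \<open>F\<close> reads c + (n1 - n2) (2 w + 1) = 0; multiply by 2 w + 1,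
    whose square is -3.\<close>
  have "of_int (9 * d) = (3 * of_int (n1 - n2) :: 'a)" by (simp flip: d3)
  also have "\<dots> = of_int c * (2 * w + 1)"
    unfolding c_def of_int_diff of_int_mult of_int_numeral using w F by algebra
  finally have r4: "(of_int (9 * d) :: 'a) = of_int c * (2 * w + 1)" .
  have q1: "(of_nat (3 * m) :: complex) = of_real (real CARD('a) - 1)" using card_field by simp
  have r5: "real (card (cubic_zeros a1 a2 a3)) = (real CARD('a))\<^sup>2 + real_of_int c * (real CARD('a) - 1)"
    if a: "a1 \<noteq> 0" "a2 \<noteq> 0" "a3 \<noteq> 0" and A: "(a1 * a2 * a3) ^ m = 1" for a1 a2 a3 :: 'a
  proof -
    have "chi (a1 * a2 * a3) = 1" using A by (simp add: chi_def)
    moreover have "conv 1 + cnj (conv 1) = of_int c"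
      unfolding J' unfolding J c_def of_int_diff of_int_mult of_int_numeral using omega_sum by algebra
    ultimately have "complex_of_nat (card (cubic_zeros a1 a2 a3))
        = of_real ((real CARD('a))\<^sup>2 + real_of_int c * (real CARD('a) - 1))"
      unfolding card_cubic_zeros[OF a] q1 by (simp add: mult.commute)
    then show ?thesis by (metis of_real_eq_iff of_real_of_nat_eq)
  qed
  have r6: "real (card (cubic_zeros a1 a2 a3))
      = (real CARD('a))\<^sup>2 + 1 / 2 * (real CARD('a) - 1) * (9 * real_of_int d - real_of_int c)"
    if a: "a1 \<noteq> 0" "a2 \<noteq> 0" "a3 \<noteq> 0" and A: "(a1 * a2 * a3) ^ m = w" for a1 a2 a3 :: 'a
  proof -
    have chi: "chi (a1 * a2 * a3) = omega" using A by (simp add: chi_def)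
    have nd: "9 * d - c = 2 * (2 * n1 - n0 - n2)" using d3 by (simp add: c_def)
    \<comment> \<open>Multiplying by the conjugate of \<open>omega\<close> rotates the coefficients,
      so \<open>n1\<close> takes the place of \<open>n0\<close> in the trace.\<close>
    have "cnj omega * conv 1 + cnj (cnj omega * conv 1) = of_int (2 * n1 - n0 - n2)"
      unfolding complex_cnj_mult complex_cnj_cnj unfolding cnj_omega J' unfolding J of_int_diff of_int_mult of_int_numeral
      using omega_sum by algebra
    also have "\<dots> = of_real (1 / 2 * real_of_int (9 * d - c))" unfolding nd by simp
    finally have "complex_of_nat (card (cubic_zeros a1 a2 a3))
        = of_real ((real CARD('a))\<^sup>2 + (real CARD('a) - 1) * (1 / 2 * real_of_int (9 * d - c)))"
      unfolding card_cubic_zeros[OF a] q1 chi by simp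
    then have "real (card (cubic_zeros a1 a2 a3))
        = (real CARD('a))\<^sup>2 + (real CARD('a) - 1) * (1 / 2 * real_of_int (9 * d - c))"
      by (metis of_real_eq_iff of_real_of_nat_eq)
    then show ?thesis by simp
  qed
  show ?thesis using that[OF r1 r2 r3 r4 r5 r6] .
qed

end

section \<open>The number of points\<close>

theorem theorem1p9:
  fixes p k q :: nat and a1 a2 a3 :: "'a::{field,finite}"
  assumes "prime p" and "[p = 1] (mod 3)" and "q = p ^ k" and "CARD('a) = q"
    and "a1 \<noteq> 0" and "a2 \<noteq> 0" and "a3 \<noteq> 0"
  shows "(is_cubic (a1 * a2 * a3) \<longrightarrow>
           (\<exists>!c. \<exists>d. norm_rep p q c d) \<and>
           (\<forall>c d. norm_rep p q c d \<longrightarrow>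
              real (card (cubic_zeros a1 a2 a3)) = real q ^ 2 + real_of_int c * (real q - 1)))
       \<and> (\<not> is_cubic (a1 * a2 * a3) \<longrightarrow>
           (\<exists>!(c, d). norm_rep p q c d \<and> sign_cong p q (a1 * a2 * a3) c d) \<and>
           (\<forall>c d. norm_rep p q c d \<and> sign_cong p q (a1 * a2 * a3) c d \<longrightarrow>
              real (card (cubic_zeros a1 a2 a3)) =
                real q ^ 2 + 1 / 2 * (real q - 1) * (9 * real_of_int d - real_of_int c)))"
proof -
  note a = \<open>a1 \<noteq> 0\<close> \<open>a2 \<noteq> 0\<close> \<open>a3 \<noteq> 0\<close>
  define A where "A = a1 * a2 * a3"
  have A0: "A \<noteq> 0" using a by (simp add: A_def)
  have p: "prime p" "p > 3"
  proof -
    have "p \<ge> 2" "p mod 3 = 1" using assms(1,2) prime_ge_2_nat by (auto simp: cong_def)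
    moreover have "p \<noteq> 2" "p \<noteq> 3" using \<open>p mod 3 = 1\<close> by auto
    ultimately show "p > 3" by linarith
  qed (rule assms(1))
  have cardp: "CARD('a) = p ^ k" using assms by simp
  note dvd_iff = of_int_eq_0_iff_dvd[OF p(1) cardp]
  have "card {0 :: 'a, 1} \<le> CARD('a)" by (intro card_mono) auto
  then have "q \<ge> 2" using assms(4) by simp
  then have k: "k > 0" using assms(3) by (cases k) auto
  define m where "m = (q - 1) div 3"
  have "[q = 1] (mod 3)" using cong_pow[OF assms(2), of k] assms(3) by simp
  then have q3: "q = 3 * m + 1" unfolding m_def cong_def using \<open>q \<ge> 2\<close> by presburger
  have m: "m > 0" "m < CARD('a) - 1" using q3 \<open>q \<ge> 2\<close> assms(4) by auto
  have three: "(3 :: 'a) \<noteq> 0"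
    using dvd_iff[of 3] p(2) by (auto dest: zdvd_imp_le)
  \<comment> \<open>Every noncube \<open>x\<close> supplies a primitive cube root of unity
    \<open>x ^ m\<close>.\<close>
  have field: "cubic_field (x ^ m) m" if "x \<noteq> 0" "x ^ m \<noteq> 1" for x :: 'a
  proof
    have "(x ^ m) ^ 3 = 1"
      using power_card_minus_1[OF that(1)] q3 assms(4) by (simp add: mult.commute flip: power_mult)
    moreover have "y\<^sup>2 + y + 1 = 0" if "y ^ 3 = 1" "y \<noteq> 1" for y :: 'a
    proof -
      have "(y - 1) * (y\<^sup>2 + y + 1) = 0" using that(1) by algebra
      then show ?thesis using that(2) by simp
    qed
    ultimately show "(x ^ m)\<^sup>2 + x ^ m + 1 = 0" using that(2) by blast
  qed (use q3 assms(4) three in auto)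
  obtain z :: 'a where z: "z \<noteq> 0" "z ^ m \<noteq> 1" using ex_power_neq_1[OF m] by blast
  \<comment> \<open>This uses the residue of \<open>p\<close> modulo 3 itself, not only its
    consequence for \<open>q\<close>.\<close>
  have binom: "(of_nat (2 * m choose m) :: 'a) \<noteq> 0"
    using prime_not_dvd_central_binomial[OF assms(1,2), of k m] q3 assms(3)
      dvd_iff[of "int (2 * m choose m)"] by simp
  have cubic: "is_cubic A \<longleftrightarrow> A ^ m = 1"
    using cubic_field.cube_iff[OF field[OF z] A0] A0 by (auto simp: is_cubic_def)
  have cop: "coprime c (int p)" if "(of_int c :: 'a) \<noteq> 0" for c
    using that p(1) dvd_iff[of c] prime_imp_coprime[of "int p" c] by (simp add: coprime_commute)
  show ?thesis
  proof (intro conjI impI, fold A_def)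
    assume "is_cubic A"
    then have A1: "(a1 * a2 * a3) ^ m = 1" using cubic by (simp add: A_def)
    \<comment> \<open>The choice of the noncube \<open>z\<close> can only change the sign of
      \<open>d\<close>, and the formula in this case involves \<open>c\<close> alone.\<close>
    obtain c d :: int where c: "norm_rep p q c d"
      and M: "real (card (cubic_zeros a1 a2 a3)) = (real q)\<^sup>2 + real_of_int c * (real q - 1)"
      using cubic_field.ex_norm_rep_and_card[OF field[OF z] binom] cop a A1 assms(4)
      unfolding norm_rep_def by metis
    have u: "c' = c" if "norm_rep p q c' d'" for c' d'
      using norm_rep_unique[OF p c[unfolded assms(3)] that[unfolded assms(3)] k] by simp
    show "\<exists>!c. \<exists>d. norm_rep p q c d" using c u by blast
    show "\<forall>c d. norm_rep p q c d \<longrightarrow>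
        real (card (cubic_zeros a1 a2 a3)) = real q ^ 2 + real_of_int c * (real q - 1)"
      using M u by blast
  next
    assume "\<not> is_cubic A"
    then have "A ^ m \<noteq> 1" using cubic by simp
    \<comment> \<open>Choosing \<open>w\<close> as \<open>A ^ m\<close> turns the field relation
      between \<open>c\<close> and \<open>d\<close> into the required congruence.\<close>
    note fld = field[OF A0 this]
    obtain c d :: int where c: "norm_rep p q c d" and c0: "(of_int c :: 'a) \<noteq> 0"
      and cd: "(of_int (9 * d) :: 'a) = of_int c * (2 * A ^ m + 1)"
      and M: "real (card (cubic_zeros a1 a2 a3))
        = (real q)\<^sup>2 + 1 / 2 * (real q - 1) * (9 * real_of_int d - real_of_int c)"
      using cubic_field.ex_norm_rep_and_card[OF fld binom] cop a assms(4)
      unfolding norm_rep_def A_def by metis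
    have sc: "sign_cong p q A c d"
    proof -
      have "coprime (2 * c) (int p)"
      proof -
        have "\<not> int p dvd 2" using p(2) by (auto dest: zdvd_imp_le)
        then show ?thesis using cop[OF c0] p(1) prime_imp_coprime[of "int p" 2] by (simp add: coprime_commute)
      qed
      \<comment> \<open>With \<open>v\<close> inverse to 2 c, solving the congruence for the residue
        gives v (9 d - c), an integer representing \<open>A ^ m\<close>.\<close>
      then obtain v where "[2 * c * v = 1] (mod int p)" using cong_solve_coprime_int by blast
      then have "int p dvd 2 * c * v - 1" by (simp add: cong_iff_dvd_diff)
      then have "(of_int (2 * c * v - 1) :: 'a) = 0" using dvd_iff by blast
      then have v: "2 * of_int c * of_int v = (1 :: 'a)" by simp
      have "of_int (v * (9 * d - c)) = of_int v * (of_int (9 * d) - of_int c :: 'a)" by simp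
      also have "\<dots> = (2 * of_int c * of_int v) * A ^ m" unfolding cd by (simp add: algebra_simps)
      also have "\<dots> = A ^ m" unfolding v by simp
      finally have t: "(of_int (v * (9 * d - c)) :: 'a) = A ^ m" .
      let ?t = "v * (9 * d - c)"
      have "(of_int (9 * d - c * (2 * ?t + 1)) :: 'a) = of_int (9 * d) - of_int c * (2 * of_int ?t + 1)"
        by simp
      also have "\<dots> = 0" unfolding t cd by simp
      finally have "[9 * d = c * (2 * ?t + 1)] (mod int p)" unfolding dvd_iff cong_iff_dvd_diff .
      then show ?thesis unfolding sign_cong_def m_def[symmetric] using t by blast
    qed
    have u: "c' = c \<and> d' = d" if n: "norm_rep p q c' d'" and s: "sign_cong p q A c' d'" for c' d'
    proof -
      have e: "c' = c" "d' = d \<or> d' = - d"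
        using norm_rep_unique[OF p c[unfolded assms(3)] n[unfolded assms(3)] k] by auto
      obtain t :: int where t: "of_int t = A ^ m" "[9 * d' = c' * (2 * t + 1)] (mod int p)"
        using s unfolding sign_cong_def m_def[symmetric] by blast
      have "(of_int (9 * d' - c' * (2 * t + 1)) :: 'a) = 0"
        using t(2) unfolding dvd_iff cong_iff_dvd_diff .
      then have "of_int (9 * d') = (of_int (9 * d) :: 'a)" using t(1) e(1) cd by simp
      \<comment> \<open>The congruence determines 9 d modulo \<open>p\<close>. With the opposite
        sign \<open>p\<close> would divide 18 d, hence \<open>d\<close>, and by the norm equation
        also \<open>c\<close>.\<close>
      moreover have False if "d' = - d" "(of_int (9 * d') :: 'a) = of_int (9 * d)"
      proof -
        have "(of_int (9 * d' - 9 * d) :: 'a) = 0" using that(2) by simp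
        then have "int p dvd 9 * d' - 9 * d" using dvd_iff by blast
        then have "int p dvd 18 * d" using that(1) by simp
        moreover have "\<not> int p dvd 18"
        proof
          assume "int p dvd 18"
          then have "int p dvd 2 * 3 * 3" by simp
          then have "int p dvd 2 \<or> int p dvd 3" using p(1) by (metis prime_dvd_mult_iff prime_nat_int_transfer)
          then show False using p(2) by (auto dest: zdvd_imp_le)
        qed
        ultimately have "int p dvd d" using p(1) by (metis prime_dvd_mult_iff prime_nat_int_transfer)
        moreover have "int p dvd int q" using k assms(3) by simp
        ultimately have "int p dvd 4 * int q - 27 * d\<^sup>2" by (simp add: power2_eq_square)
        then have "int p dvd c\<^sup>2" using c by (simp add: norm_rep_def)
        then have "int p dvd c" using p(1) prime_dvd_power by (metis prime_nat_int_transfer)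
        then show False using c0 dvd_iff by blast
      qed
      ultimately show ?thesis using e by blast
    qed
    show "\<exists>!(c, d). norm_rep p q c d \<and> sign_cong p q A c d"
    proof (rule ex1I[of _ "(c, d)"])
      fix y assume "case y of (c, d) \<Rightarrow> norm_rep p q c d \<and> sign_cong p q A c d"
      then show "y = (c, d)" using u[of "fst y" "snd y"] by (simp add: case_prod_unfold prod_eq_iff)
    qed (use c sc in simp)
    show "\<forall>c d. norm_rep p q c d \<and> sign_cong p q A c d \<longrightarrow>
        real (card (cubic_zeros a1 a2 a3)) =
          real q ^ 2 + 1 / 2 * (real q - 1) * (9 * real_of_int d - real_of_int c)"
      using M u by blast
  qed
qed

end
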